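(* For all non-negative integers $n, j$ and all integers $r\geq 2$, $$\frac{1}{r-1}\,b_{j,r}(n)=(j+1)\,|\mathcal{O}_{j+1,r}(n)|-j\,|\mathcal{O}_{j,r}(n)|=(j+1)\,|\mathcal{D}_{j+1,r}(n)|-j\,|\mathcal{D}_{j,r}(n)|,$$ where $$b_{j,r}(n)=\sum_{\lambda\in \mathcal{O}_{j,r}(n)} \ell(\lambda)-\sum_{\lambda\in \mathcal{D}_{j,r}(n)} \ell(\lambda).$$
   Context: A partition $\lambda$ of a non-negative integer $n$ is a non-increasing finite sequence of positive integers $(\lambda_1,\ldots,\lambda_\ell)$ (its parts) with sum $n$; the empty partition is the only partition of $0$. The length $\ell(\lambda)$ is the number of parts of $\lambda$, counted with multiplicity. For integers $j\ge 0$, $r\ge 2$, $n \ge 0$: - $\mathcal{O}_{j,r}(n)$ is the set of partitions of $n$ with exactly $j$ different parts divisible by $r$. Here different means distinct part values; these parts may be repeated. - $\mathcal{D}_{j,r}(n)$ is the set of partitions of $n$ in which exactly $j$ different parts are repeated at least $r$ times (i.e. have multiplicity at least $r$), all other parts appearing at most $r-1$ times. All differences are taken in $\mathbb{Z}$ (they may be negative). *)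

theory Defs
  imports Complex_Main
begin

definition partitions :: "nat \<Rightarrow> nat list set" where
  "partitions n = {p. sorted_wrt (\<ge>) p \<and> (\<forall>x\<in>set p. 0 < x) \<and> sum_list p = n}"

definition O_set :: "nat \<Rightarrow> nat \<Rightarrow> nat \<Rightarrow> nat list set" where
  "O_set j r n = {p \<in> partitions n. card {x \<in> set p. r dvd x} = j}"

definition D_set :: "nat \<Rightarrow> nat \<Rightarrow> nat \<Rightarrow> nat list set" where
  "D_set j r n = {p \<in> partitions n. card {x \<in> set p. r \<le> count_list p x} = j}"

definition b :: "nat \<Rightarrow> nat \<Rightarrow> nat \<Rightarrow> int" where
  "b j r n = (\<Sum>p\<in>O_set j r n. int (length p)) - (\<Sum>p\<in>D_set j r n. int (length p))"

text \<open>The cardinalities and sums above range over finite sets, so none of them takes the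
  default value 0 for infinite sets.\<close>

lemma length_le_sum_list:
  fixes p :: "nat list"
  assumes "\<forall>x\<in>set p. 0 < x"
  shows "length p \<le> sum_list p"
  using assms by (induction p) auto

lemma finite_partitions: "finite (partitions n)"
proof (rule finite_subset)
  show "partitions n \<subseteq> {p. set p \<subseteq> {..n} \<and> length p \<le> n}"
    using length_le_sum_list member_le_sum_list by (fastforce simp: partitions_def)
  show "finite {p. set p \<subseteq> {..n} \<and> length p \<le> n}"
    by (rule finite_lists_length_le) simp
qed

lemma finite_O_set: "finite (O_set j r n)"
  unfolding O_set_def using finite_partitions by simp

lemma finite_D_set: "finite (D_set j r n)"
  unfolding D_set_def using finite_partitions by simp

end

theory Submission
  imports Defs "HOL-Library.Multiset" "HOL-Computational_Algebra.Formal_Laurent_Series"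
begin

text \<open>
  Write \<open>F(x)\<close> for the generating function of all partitions, each weighted by some function
  \<open>f\<close> of its number of different parts, and \<open>L(x)\<close> for the same series with each partition
  weighted in addition by its length.  The case of interest is that \<open>f\<close> is the indicator of
  \<open>j\<close>.

  A partition can be cut into a core and a second partition \<open>B\<close> in two ways
  (lemmas \<open>splitting_divisible\<close> and \<open>splitting_repeated\<close>).  Either the
  parts divisible by \<open>r\<close> are taken out and divided by \<open>r\<close>, leaving a core without multiples
  of \<open>r\<close>; or as many blocks of \<open>r\<close> equal parts as possible are taken out, one part being kept
  for each block, leaving a core with all multiplicities below \<open>r\<close>.  In both cases \<open>B\<close> is
  arbitrary, contributes \<open>r\<close> times its sum, and its different parts are exactly those counted by
  the statistic that defines \<open>O\<close>, respectively \<open>D\<close>.  So if \<open>R\<close> and \<open>R'\<close> enumerate the cores,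
  the weighted counts are \<open>R(x) F(x^r)\<close> and \<open>R'(x) F(x^r)\<close>.  For \<open>f = 1\<close> both count all
  partitions; cancelling gives \<open>R = R'\<close> (Glaisher), hence the equality of the two counts for
  every \<open>f\<close>.

  The length of the whole is that of the core plus that of \<open>B\<close> in the first case, and that of the
  core plus \<open>r\<close> times that of \<open>B\<close> in the second.  The difference of the total lengths is
  therefore \<open>E(x) F(x^r) - (r - 1) R(x) L(x^r)\<close>, where \<open>E\<close> is the difference of the total lengths
  of the cores and does not depend on \<open>f\<close>.  For \<open>f = 1\<close> this difference vanishes, since all
  partitions are enumerated on both sides.  That determines \<open>E\<close> once \<open>L\<close> is known for
  \<open>f = 1\<close>; lemma \<open>length_gf_diff_of_splittings\<close> carries this out.

  The remaining relation between \<open>F\<close> and \<open>L\<close> comes from adding \<open>i \<ge> 1\<close> copies of one part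
  \<open>k\<close> to a partition (lemma \<open>part_gf_times_rect_gf\<close>): if \<open>T\<close> enumerates the pairs \<open>(k, i)\<close>
  by \<open>i k\<close>, then \<open>F T = L + G\<close>, where \<open>G\<close> weights a partition with \<open>c\<close> different parts by
  \<open>c (f(c - 1) - f(c))\<close>.  For \<open>f = 1\<close> it says \<open>L = F T\<close>, so that
  \<open>E(x) = (r - 1) R(x) T(x^r)\<close>, and for general \<open>f\<close> the difference of the total lengths becomes
  \<open>(r - 1) R(x) (F T - L)(x^r) = (r - 1) R(x) G(x^r)\<close>.  If \<open>f\<close> is the indicator of \<open>j\<close>, the
  weight in \<open>G\<close> is \<open>j + 1\<close> at \<open>c = j + 1\<close> and \<open>-j\<close> at \<open>c = j\<close>, which is the claim.
\<close>

unbundle fps_syntax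

section \<open>Weighted generating functions\<close>

definition finite_fibres :: "('a \<Rightarrow> nat) \<Rightarrow> 'a set \<Rightarrow> bool" where
  "finite_fibres sz S \<longleftrightarrow> (\<forall>n. finite {x \<in> S. sz x = n})"

text \<open>A coefficient is a sum over a fibre of \<open>sz\<close>, and it is 0 if that fibre is infinite; this
  is why products are formed under \<open>finite_fibres\<close>.\<close>

definition gf :: "('a \<Rightarrow> nat) \<Rightarrow> 'a set \<Rightarrow> ('a \<Rightarrow> int) \<Rightarrow> int fps" where
  "gf sz S w = Abs_fps (\<lambda>n. \<Sum>x | x \<in> S \<and> sz x = n. w x)"

lemma gf_nth: "gf sz S w $ n = (\<Sum>x | x \<in> S \<and> sz x = n. w x)"
  by (simp add: gf_def)

lemma gf_add: "gf sz S (\<lambda>x. u x + v x) = gf sz S u + gf sz S v"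
  by (rule fps_ext) (simp add: gf_nth sum.distrib)

lemma gf_diff: "gf sz S (\<lambda>x. u x - v x) = gf sz S u - gf sz S v"
  by (rule fps_ext) (simp add: gf_nth sum_subtractf)

lemma gf_scale: "gf sz S (\<lambda>x. a * u x) = fps_const a * gf sz S u"
  by (rule fps_ext) (simp add: gf_nth sum_distrib_left)

lemma gf_transport:
  assumes h: "bij_betw h S S'"
    and sz: "\<And>x. x \<in> S \<Longrightarrow> sz' (h x) = sz x"
    and w: "\<And>x. x \<in> S \<Longrightarrow> w' (h x) = w x"
  shows "gf sz S w = gf sz' S' w'"
proof (rule fps_ext)
  fix n
  have "bij_betw h {x \<in> S. sz x = n} {y \<in> S'. sz' y = n}"
    unfolding bij_betw_def
  proof
    show "inj_on h {x \<in> S. sz x = n}"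
      using h by (auto simp: bij_betw_def inj_on_def)
    show "h ` {x \<in> S. sz x = n} = {y \<in> S'. sz' y = n}"
      using h sz by (fastforce simp: bij_betw_def)
  qed
  from sum.reindex_bij_betw[OF this, of w'] w
  show "gf sz S w $ n = gf sz' S' w' $ n"
    by (simp add: gf_nth)
qed

lemma gf_mult:
  assumes "finite_fibres sz S" "finite_fibres sz' S'"
  shows "gf sz S w * gf sz' S' w' =
         gf (\<lambda>(x, y). sz x + sz' y) (S \<times> S') (\<lambda>(x, y). w x * w' y)"
proof (rule fps_ext)
  fix n
  let ?A = "\<lambda>i. {x \<in> S. sz x = i}" and ?B = "\<lambda>i. {y \<in> S'. sz' y = i}"
  have fin: "finite (?A i)" "finite (?B i)" for i
    using assms by (auto simp: finite_fibres_def)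
  have "{z. z \<in> S \<times> S' \<and> (case z of (x, y) \<Rightarrow> sz x + sz' y) = n} =
        (\<Union>i\<in>{0..n}. ?A i \<times> ?B (n - i))"
    by auto
  moreover have "(\<Sum>z\<in>(\<Union>i\<in>{0..n}. ?A i \<times> ?B (n - i)). case z of (x, y) \<Rightarrow> w x * w' y) =
        (\<Sum>i=0..n. \<Sum>z\<in>?A i \<times> ?B (n - i). case z of (x, y) \<Rightarrow> w x * w' y)"
    by (rule sum.UNION_disjoint) (use fin in auto)
  ultimately show "(gf sz S w * gf sz' S' w') $ n =
    gf (\<lambda>(x, y). sz x + sz' y) (S \<times> S') (\<lambda>(x, y). w x * w' y) $ n"
    by (simp add: gf_nth fps_mult_nth sum_product sum.cartesian_product)
qed

lemma gf_dilate:
  assumes "0 < r"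
  shows "gf (\<lambda>x. r * sz x) S w = gf sz S w oo fps_X ^ r"
proof (rule fps_ext)
  fix n
  have "{x \<in> S. r * sz x = n} = (if r dvd n then {x \<in> S. sz x = n div r} else {})"
    using assms by auto
  then show "gf (\<lambda>x. r * sz x) S w $ n = (gf sz S w oo fps_X ^ r) $ n"
    using assms by (simp add: gf_nth fps_nth_compose_X_power)
qed

lemma finite_fibres_dilate:
  assumes "0 < r" "finite_fibres sz S"
  shows "finite_fibres (\<lambda>x. r * sz x) S"
  unfolding finite_fibres_def
proof
  fix n
  have "{x \<in> S. r * sz x = n} \<subseteq> {x \<in> S. sz x = n div r}"
    using assms(1) by auto
  with assms(2) show "finite {x \<in> S. r * sz x = n}"
    unfolding finite_fibres_def by (blast intro: finite_subset)
qed

lemma gf_Sigma: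
  assumes "finite_fibres sz S" "\<And>x. x \<in> S \<Longrightarrow> finite (K x)"
  shows "gf (\<lambda>z. sz (fst z)) (Sigma S K) w = gf sz S (\<lambda>x. \<Sum>y\<in>K x. w (x, y))"
proof (rule fps_ext)
  fix n
  have "{z \<in> Sigma S K. sz (fst z) = n} = Sigma {x \<in> S. sz x = n} K"
    by auto
  with assms show "gf (\<lambda>z. sz (fst z)) (Sigma S K) w $ n =
    gf sz S (\<lambda>x. \<Sum>y\<in>K x. w (x, y)) $ n"
    by (simp add: gf_nth sum.Sigma finite_fibres_def)
qed

section \<open>Partitions as multisets\<close>

text \<open>Multisets make the union of partitions and the repetition of parts algebraic operations;
  sorting identifies them with the non-increasing lists.\<close>

definition Par :: "nat multiset set" where
  "Par = {M. 0 \<notin># M}"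

lemma bij_betw_mset_partitions:
  "bij_betw mset (partitions n) {M \<in> Par. sum_mset M = n}"
proof (rule bij_betw_byWitness[where f' = "\<lambda>M. rev (sorted_list_of_multiset M)"])
  show "\<forall>p\<in>partitions n. rev (sorted_list_of_multiset (mset p)) = p"
  proof
    fix p assume "p \<in> partitions n"
    then have "sorted (rev p)"
      by (simp add: partitions_def sorted_wrt_rev)
    then have "sorted_list_of_multiset (mset p) = rev p"
      by (metis mset_rev sorted_list_of_multiset_mset sorted_sort_id)
    then show "rev (sorted_list_of_multiset (mset p)) = p"
      by simp
  qed
  show "mset ` partitions n \<subseteq> {M \<in> Par. sum_mset M = n}"
    by (auto simp: partitions_def Par_def sum_mset_sum_list)
  show "(\<lambda>M. rev (sorted_list_of_multiset M)) ` {M \<in> Par. sum_mset M = n} \<subseteq> partitions n"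
    by (auto simp: partitions_def Par_def sorted_wrt_rev
        simp flip: sum_mset_sum_list intro: gr0I)
qed auto

lemma finite_fibres_Par: "finite_fibres sum_mset Par"
  using bij_betw_finite[OF bij_betw_mset_partitions] finite_partitions
  by (auto simp: finite_fibres_def)

lemma gf_Par_nth:
  "gf sum_mset Par w $ n = (\<Sum>p\<in>partitions n. w (mset p))"
  unfolding gf_nth by (rule sum.reindex_bij_betw[OF bij_betw_mset_partitions, symmetric])

section \<open>Adjoining a rectangle\<close>

abbreviation distinct_parts :: "nat multiset \<Rightarrow> nat" where
  "distinct_parts M \<equiv> card (set_mset M)"

text \<open>For \<open>n \<ge> 1\<close> the coefficient of \<open>x^n\<close> is the number of divisors of \<open>n\<close>: a pair \<open>(k, i)\<close> stands for
  the rectangle of \<open>i\<close> parts equal to \<open>k\<close>.\<close>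

definition rect_gf :: "int fps" where
  "rect_gf = gf (\<lambda>(k, i). i * k) ({0<..} \<times> {0<..}) (\<lambda>_. 1)"

lemma finite_fibres_rect: "finite_fibres (\<lambda>(k, i). i * k) ({0<..} \<times> {0<..} :: (nat \<times> nat) set)"
  unfolding finite_fibres_def
proof
  fix n :: nat
  have "{x \<in> {0<..} \<times> {0<..}. (case x of (k, i) \<Rightarrow> i * k) = n} \<subseteq> {..n} \<times> {..n}"
    by auto
  then show "finite {x \<in> {0<..} \<times> {0<..}. (case x of (k, i) \<Rightarrow> i * k) = n}"
    by (rule finite_subset) simp
qed

text \<open>Adding \<open>i\<close> copies of \<open>k\<close> loses no information once \<open>(k, i)\<close> is remembered, and what
  can be reached are exactly the rectangles contained in the resulting partition.\<close>

lemma bij_betw_adjoin_rect: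
  "bij_betw (\<lambda>(B, k, i). (B + replicate_mset i k, k, i)) (Par \<times> {0<..} \<times> {0<..})
     (SIGMA M:Par. SIGMA k:set_mset M. {1..count M k})"
proof (rule bij_betw_byWitness[where f' = "\<lambda>(M, k, i). (M - replicate_mset i k, k, i)"])
  show "(\<lambda>(M, k, i). (M - replicate_mset i k, k, i)) `
    (SIGMA M:Par. SIGMA k:set_mset M. {1..count M k}) \<subseteq> Par \<times> {0<..} \<times> {0<..}"
    by (auto simp: Par_def intro: gr0I dest: in_diffD)
next
  show "\<forall>a'\<in>SIGMA M:Par. SIGMA k:set_mset M. {1..count M k}.
    (\<lambda>(B, k, i). (B + replicate_mset i k, k, i))
      ((\<lambda>(M, k, i). (M - replicate_mset i k, k, i)) a') = a'"
    by (auto simp flip: count_le_replicate_mset_subset_eq)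
qed (auto simp: Par_def)

lemma set_mset_diff_replicate:
  assumes "k \<in># M" "i \<le> count M k"
  shows "set_mset (M - replicate_mset i k) =
         (if i = count M k then set_mset M - {k} else set_mset M)"
  using assms by (auto simp: set_eq_iff simp flip: count_greater_zero_iff)

text \<open>A partition contains \<open>size M\<close> rectangles \<open>(k, i)\<close>.  Removing one lowers the number of
  different parts only if it takes all copies of \<open>k\<close>, which happens once for each different part
  \<open>k\<close>.\<close>

lemma sum_remove_rect:
  fixes f :: "nat \<Rightarrow> int"
  shows "(\<Sum>(k, i)\<in>(SIGMA k:set_mset M. {1..count M k}).
            f (distinct_parts (M - replicate_mset i k))) =
         f (distinct_parts M) * (int (size M) - int (distinct_parts M)) +
         int (distinct_parts M) * f (distinct_parts M - 1)"
proof -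
  have inner: "(\<Sum>i=1..count M k. f (distinct_parts (M - replicate_mset i k))) =
      f (distinct_parts M) * (int (count M k) - 1) + f (distinct_parts M - 1)"
    if k: "k \<in># M" for k
  proof -
    have "count M k > 0" using k by simp
    then have "{1..count M k} = insert (count M k) {1..<count M k}" by auto
    moreover have "(\<Sum>i\<in>{1..<count M k}. f (distinct_parts (M - replicate_mset i k))) =
        (\<Sum>i\<in>{1..<count M k}. f (distinct_parts M))"
      by (rule sum.cong) (use k in \<open>auto simp: set_mset_diff_replicate\<close>)
    ultimately show ?thesis
      using \<open>count M k > 0\<close> k by (simp add: set_mset_diff_replicate of_nat_diff algebra_simps)
  qed
  have "(\<Sum>(k, i)\<in>(SIGMA k:set_mset M. {1..count M k}).
            f (distinct_parts (M - replicate_mset i k))) =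
      (\<Sum>k\<in>set_mset M. \<Sum>i=1..count M k. f (distinct_parts (M - replicate_mset i k)))"
    by (rule sum.Sigma[symmetric]) auto
  also have "\<dots> = (\<Sum>k\<in>set_mset M. f (distinct_parts M) * (int (count M k) - 1) + f (distinct_parts M - 1))"
    by (rule sum.cong[OF refl inner])
  also have "\<dots> = f (distinct_parts M) * (\<Sum>k\<in>set_mset M. int (count M k) - 1) +
      int (distinct_parts M) * f (distinct_parts M - 1)"
    by (simp add: sum.distrib sum_distrib_left)
  also have "(\<Sum>k\<in>set_mset M. int (count M k) - 1) = int (size M) - int (distinct_parts M)"
    by (simp add: sum_subtractf size_multiset_overloaded_eq)
  finally show ?thesis .
qed

text \<open>An arbitrary weight \<open>f\<close> of the number of different parts, rather than a fixed number of
  them, allows the same identity to be used for one \<open>j\<close> and, with \<open>f = 1\<close>, for all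
  partitions at once.\<close>

definition part_gf :: "(nat \<Rightarrow> int) \<Rightarrow> int fps" where
  "part_gf f = gf sum_mset Par (\<lambda>M. f (distinct_parts M))"

definition length_gf :: "(nat \<Rightarrow> int) \<Rightarrow> int fps" where
  "length_gf f = gf sum_mset Par (\<lambda>M. f (distinct_parts M) * int (size M))"

text \<open>The correction that arises because each of the \<open>c\<close> full rectangles of a partition takes away
  one different part.  At \<open>c = 0\<close> the factor \<open>c\<close> annihilates the truncated \<open>c - 1\<close>.\<close>

definition shift_weight :: "(nat \<Rightarrow> int) \<Rightarrow> nat \<Rightarrow> int" where
  "shift_weight f c = int c * (f (c - 1) - f c)"

text \<open>The left side enumerates pairs of a partition and a rectangle.  Joining them and summing over
  the rectangles inside the union, with the weight of what remains after their removal, gives the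
  right side.\<close>

lemma part_gf_times_rect_gf:
  "part_gf f * rect_gf = length_gf f + part_gf (shift_weight f)"
proof -
  have "part_gf f * rect_gf =
      gf (\<lambda>(B, k, i). sum_mset B + i * k) (Par \<times> {0<..} \<times> {0<..}) (\<lambda>(B, k, i). f (distinct_parts B))"
    unfolding part_gf_def rect_gf_def gf_mult[OF finite_fibres_Par finite_fibres_rect]
    by (simp add: case_prod_unfold)
  also have "\<dots> = gf (\<lambda>z. sum_mset (fst z)) (SIGMA M:Par. SIGMA k:set_mset M. {1..count M k})
      (\<lambda>(M, k, i). f (distinct_parts (M - replicate_mset i k)))"
    by (rule gf_transport[OF bij_betw_adjoin_rect]) auto
  also have "\<dots> = gf sum_mset Par (\<lambda>M. \<Sum>(k, i)\<in>(SIGMA k:set_mset M. {1..count M k}).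
      f (distinct_parts (M - replicate_mset i k)))"
    by (subst gf_Sigma[OF finite_fibres_Par]) auto
  also have "\<dots> = gf sum_mset Par (\<lambda>M. f (distinct_parts M) * int (size M) + shift_weight f (distinct_parts M))"
    unfolding sum_remove_rect by (simp add: shift_weight_def algebra_simps)
  finally show ?thesis
    by (simp add: part_gf_def length_gf_def gf_add)
qed

section \<open>Splitting off a dilated partition\<close>

text \<open>Every partition arises uniquely by glueing a core \<open>A \<in> S\<close> to a partition \<open>B\<close> scaled up by
  \<open>r\<close>.  Each part of \<open>B\<close> becomes \<open>c\<close> parts of the union, and \<open>stat\<close> recovers the number of
  different parts of \<open>B\<close>.  Scaling the part sizes is the case \<open>c = 1\<close>, scaling the
  multiplicities the case \<open>c = r\<close>.\<close>

locale splitting =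
  fixes r c :: nat and S :: "nat multiset set"
    and glue :: "nat multiset \<times> nat multiset \<Rightarrow> nat multiset"
    and stat :: "nat multiset \<Rightarrow> nat"
  assumes r_pos: "0 < r"
    and S_Par: "S \<subseteq> Par"
    and bij_glue: "bij_betw glue (S \<times> Par) Par"
    and sum_glue: "\<And>A B. A \<in> S \<Longrightarrow> B \<in> Par \<Longrightarrow> sum_mset (glue (A, B)) = sum_mset A + r * sum_mset B"
    and size_glue: "\<And>A B. A \<in> S \<Longrightarrow> B \<in> Par \<Longrightarrow> size (glue (A, B)) = size A + c * size B"
    and stat_glue: "\<And>A B. A \<in> S \<Longrightarrow> B \<in> Par \<Longrightarrow> stat (glue (A, B)) = distinct_parts B"
begin

abbreviation core_gf :: "int fps" where
  "core_gf \<equiv> gf sum_mset S (\<lambda>_. 1)"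

abbreviation core_length_gf :: "int fps" where
  "core_length_gf \<equiv> gf sum_mset S (\<lambda>A. int (size A))"

abbreviation stat_gf :: "(nat \<Rightarrow> int) \<Rightarrow> int fps" where
  "stat_gf f \<equiv> gf sum_mset Par (\<lambda>M. f (stat M))"

abbreviation stat_length_gf :: "(nat \<Rightarrow> int) \<Rightarrow> int fps" where
  "stat_length_gf f \<equiv> gf sum_mset Par (\<lambda>M. f (stat M) * int (size M))"

lemma finite_fibres_core: "finite_fibres sum_mset S"
  unfolding finite_fibres_def
proof
  fix n
  have "{A \<in> S. sum_mset A = n} \<subseteq> {A \<in> Par. sum_mset A = n}"
    using S_Par by blast
  moreover have "finite {A \<in> Par. sum_mset A = n}"
    using finite_fibres_Par by (simp add: finite_fibres_def)
  ultimately show "finite {A \<in> S. sum_mset A = n}"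
    by (rule finite_subset)
qed

lemma gf_glue:
  "gf sum_mset S u * (gf sum_mset Par v oo fps_X ^ r) =
   gf (\<lambda>(A, B). sum_mset A + r * sum_mset B) (S \<times> Par) (\<lambda>(A, B). u A * v B)"
  by (simp add: gf_mult[OF finite_fibres_core finite_fibres_dilate[OF r_pos finite_fibres_Par]]
      flip: gf_dilate[OF r_pos])

lemma stat_gf_eq: "stat_gf f = core_gf * (part_gf f oo fps_X ^ r)"
  unfolding part_gf_def gf_glue
  by (rule gf_transport[OF bij_glue, symmetric]) (auto simp: sum_glue stat_glue)

lemma stat_length_gf_eq:
  "stat_length_gf f = core_length_gf * (part_gf f oo fps_X ^ r) +
     of_nat c * core_gf * (length_gf f oo fps_X ^ r)"
proof -
  have "stat_length_gf f = gf (\<lambda>(A, B). sum_mset A + r * sum_mset B) (S \<times> Par)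
      (\<lambda>z. (case z of (A, B) \<Rightarrow> int (size A) * f (distinct_parts B)) +
           int c * (case z of (A, B) \<Rightarrow> 1 * (f (distinct_parts B) * int (size B))))"
    by (rule gf_transport[OF bij_glue, symmetric])
       (auto simp: sum_glue stat_glue size_glue algebra_simps)
  then show ?thesis
    unfolding part_gf_def length_gf_def gf_add gf_scale gf_glue[symmetric]
    by (simp add: fps_of_nat mult.assoc)
qed

end

text \<open>The two cores are never compared directly.  The constant weight \<open>f = 1\<close> turns both sides into
  the enumeration of all partitions, and cancelling the common nonzero factor determines what is needed
  about the cores: their numbers agree, and the difference of their total lengths is
  \<open>(r - 1)\<close> times the cores joined to a dilated rectangle.\<close>

lemma length_gf_diff_of_splittings:
  assumes "splitting r 1 S glue stat" "splitting r r S' glue' stat'"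
  shows "gf sum_mset Par (\<lambda>M. f (stat M)) = gf sum_mset Par (\<lambda>M. f (stat' M))" (is ?count)
    and "gf sum_mset Par (\<lambda>M. f (stat M) * int (size M)) -
         gf sum_mset Par (\<lambda>M. f (stat' M) * int (size M)) =
         (of_nat r - 1) * gf sum_mset Par (\<lambda>M. shift_weight f (stat M))" (is ?length)
proof -
  interpret one: splitting r 1 S glue stat by fact
  interpret rep: splitting r r S' glue' stat' by fact
  let ?d = "\<lambda>F :: int fps. F oo fps_X ^ r"
  have dm: "?d (F * G) = ?d F * ?d G" for F G
    using one.r_pos by (intro fps_compose_mult_distrib) simp
  \<comment> \<open>the empty partition makes the factor to be cancelled nonzero\<close>
  have "part_gf (\<lambda>_. 1) $ 0 = 1"
  proof -
    have "{M \<in> Par. sum_mset M = 0} = {{#}}"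
      by (auto simp: Par_def) (metis multiset_nonemptyE)
    then show ?thesis by (simp add: part_gf_def gf_nth)
  qed
  then have nz: "?d (part_gf (\<lambda>_. 1)) \<noteq> 0"
    by (metis fps_compose_nth_0 fps_zero_nth zero_neq_one)
  have core: "one.core_gf = rep.core_gf"
    using one.stat_gf_eq[of "\<lambda>_. 1"] rep.stat_gf_eq[of "\<lambda>_. 1"] nz by simp
  then show ?count
    by (simp add: one.stat_gf_eq rep.stat_gf_eq)
  let ?B = "one.core_length_gf - rep.core_length_gf"
  have diff: "one.stat_length_gf f - rep.stat_length_gf f =
      ?B * ?d (part_gf f) - (of_nat r - 1) * one.core_gf * ?d (length_gf f)" for f
    unfolding one.stat_length_gf_eq rep.stat_length_gf_eq core by (simp add: algebra_simps)
  have len1: "length_gf (\<lambda>_. 1) = part_gf (\<lambda>_. 1) * rect_gf"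
  proof -
    have "part_gf (shift_weight (\<lambda>_. 1)) = 0"
      by (rule fps_ext) (simp add: part_gf_def gf_nth shift_weight_def)
    then show ?thesis using part_gf_times_rect_gf[of "\<lambda>_. 1"] by simp
  qed
  \<comment> \<open>for weight 1 both total lengths are that of all partitions, so the left side of \<open>diff\<close> is 0\<close>
  have "?B * ?d (part_gf (\<lambda>_. 1)) =
      ((of_nat r - 1) * one.core_gf * ?d rect_gf) * ?d (part_gf (\<lambda>_. 1))"
    using diff[of "\<lambda>_. 1"] by (simp add: len1 dm algebra_simps)
  with nz have B: "?B = (of_nat r - 1) * one.core_gf * ?d rect_gf"
    using mult_right_cancel by blast
  have shifted: "?d (part_gf (shift_weight f)) = ?d (part_gf f) * ?d rect_gf - ?d (length_gf f)"
    by (simp add: part_gf_times_rect_gf fps_compose_add_distrib flip: dm)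
  show ?length
    unfolding diff B one.stat_gf_eq[of "shift_weight f"] shifted
    by (simp add: algebra_simps)
qed

section \<open>Divisible parts and repeated parts\<close>

text \<open>The multiples of \<open>r\<close> among the parts, divided by \<open>r\<close>, form an arbitrary partition, and the
  other parts form the core.\<close>

lemma splitting_divisible:
  assumes "0 < r"
  shows "splitting r 1 {A \<in> Par. \<forall>x\<in>#A. \<not> r dvd x}
           (\<lambda>(A, B). A + image_mset ((*) r) B) (\<lambda>M. card {x \<in> set_mset M. r dvd x})"
proof
  let ?S = "{A \<in> Par. \<forall>x\<in>#A. \<not> r dvd x}"
  let ?g = "\<lambda>(A, B). A + image_mset ((*) r) B"
  show "bij_betw ?g (?S \<times> Par) Par"
  proof (rule bij_betw_byWitness[where f' = "\<lambda>M. (filter_mset (\<lambda>x. \<not> r dvd x) M,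
      image_mset (\<lambda>x. x div r) (filter_mset ((dvd) r) M))"])
    show "\<forall>M\<in>Par. ?g (filter_mset (\<lambda>x. \<not> r dvd x) M,
        image_mset (\<lambda>x. x div r) (filter_mset ((dvd) r) M)) = M"
    proof
      fix M :: "nat multiset"
      have "image_mset (\<lambda>x. r * (x div r)) (filter_mset ((dvd) r) M) =
          image_mset id (filter_mset ((dvd) r) M)"
        by (rule image_mset_cong) auto
      then show "?g (filter_mset (\<lambda>x. \<not> r dvd x) M,
        image_mset (\<lambda>x. x div r) (filter_mset ((dvd) r) M)) = M"
        using multiset_partition[of M "(dvd) r"]
        by (simp add: image_mset.compositionality o_def add.commute)
    qed
  qed (use assms in \<open>auto simp: Par_def image_mset.compositionality o_def filter_mset_image_mset
        filter_mset_eq_conv dvd_div_eq_0_iff intro!: image_mset_cong\<close>)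
  fix A B assume "A \<in> ?S" "B \<in> Par"
  then have "{x \<in> set_mset (?g (A, B)). r dvd x} = (*) r ` set_mset B"
    by auto
  then show "card {x \<in> set_mset (?g (A, B)). r dvd x} = distinct_parts B"
    using assms by (simp add: card_image inj_on_def)
qed (use assms in \<open>auto simp: sum_mset_distrib_left[where f = "\<lambda>x. x", simplified]\<close>)

text \<open>Division with remainder of every multiplicity by \<open>r\<close>: the remainders are the multiplicities
  of the core and the quotients those of \<open>B\<close>.  A multiplicity is at least \<open>r\<close> exactly if its
  quotient is positive.\<close>

lemma splitting_repeated:
  assumes "0 < r"
  shows "splitting r r {A \<in> Par. \<forall>x. count A x < r}
           (\<lambda>(A, B). A + repeat_mset r B) (\<lambda>M. card {x \<in> set_mset M. r \<le> count M x})"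
proof
  let ?S = "{A \<in> Par. \<forall>x. count A x < r}"
  let ?g = "\<lambda>(A, B). A + repeat_mset r B"
  define quo where "quo M = Abs_multiset (\<lambda>x. count M x div r)" for M :: "nat multiset"
  define rem where "rem M = Abs_multiset (\<lambda>x. count M x mod r)" for M :: "nat multiset"
  have quo: "count (quo M) x = count M x div r" for M x
  proof -
    have "{x. 0 < count M x div r} \<subseteq> set_mset M"
      using assms by (auto simp: div_greater_zero_iff simp flip: count_greater_zero_iff)
    then show ?thesis
      unfolding quo_def by (subst count_Abs_multiset) (auto intro: finite_subset)
  qed
  have rem: "count (rem M) x = count M x mod r" for M x
  proof -
    have "{x. 0 < count M x mod r} \<subseteq> set_mset M"
      by (auto intro!: count_inI)
    then show ?thesis
      unfolding rem_def by (subst count_Abs_multiset) (auto intro: finite_subset)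
  qed
  show "bij_betw ?g (?S \<times> Par) Par"
    by (rule bij_betw_byWitness[where f' = "\<lambda>M. (rem M, quo M)"])
       (use assms in \<open>auto simp: Par_def multiset_eq_iff quo rem not_in_iff\<close>)
  fix A B assume A: "A \<in> ?S" and "B \<in> Par"
  show "sum_mset (?g (A, B)) = sum_mset A + r * sum_mset B"
  proof -
    have "sum_mset (repeat_mset r B) = r * sum_mset B"
      by (induction r) auto
    then show ?thesis by simp
  qed
  show "size (?g (A, B)) = size A + r * size B"
    by simp
  have "{x \<in> set_mset (?g (A, B)). r \<le> count (?g (A, B)) x} = set_mset B"
  proof -
    have "r \<le> count A x + r * count B x \<longleftrightarrow> count B x > 0" for x
      using A by (cases "count B x") (auto simp: not_le)
    moreover have "x \<in># repeat_mset r B \<longleftrightarrow> x \<in># B" for x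
      using assms by (simp flip: count_greater_zero_iff)
    ultimately show ?thesis by auto
  qed
  then show "card {x \<in> set_mset (?g (A, B)). r \<le> count (?g (A, B)) x} = distinct_parts B"
    by simp
qed (use assms in auto)

section \<open>Counting parts divisible by r and parts repeated r times\<close>

lemma shift_weight_indicator:
  "shift_weight (\<lambda>c. of_bool (c = j)) c =
   (int j + 1) * of_bool (c = j + 1) - int j * of_bool (c = j)"
  by (cases c) (auto simp: shift_weight_def)

lemma O_set_sum:
  "(\<Sum>p\<in>O_set j r n. w (mset p)) =
   gf sum_mset Par (\<lambda>M. of_bool (card {x \<in> set_mset M. r dvd x} = j) * w M) $ n"
  unfolding gf_Par_nth O_set_def
  by (simp add: sum.inter_filter finite_partitions of_bool_def if_distrib[of "\<lambda>a. a * _"] cong: if_cong)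

lemma D_set_sum:
  "(\<Sum>p\<in>D_set j r n. w (mset p)) =
   gf sum_mset Par (\<lambda>M. of_bool (card {x \<in> set_mset M. r \<le> count M x} = j) * w M) $ n"
  unfolding gf_Par_nth D_set_def
  by (simp add: sum.inter_filter finite_partitions of_bool_def if_distrib[of "\<lambda>a. a * _"] count_mset cong: if_cong)

theorem theorem3:
  fixes n j r :: nat
  assumes "2 \<le> r"
  shows "1 / (rat_of_nat r - 1) * rat_of_int (b j r n) =
           rat_of_int ((int j + 1) * int (card (O_set (j + 1) r n)) - int j * int (card (O_set j r n)))
       \<and> (int j + 1) * int (card (O_set (j + 1) r n)) - int j * int (card (O_set j r n)) =
           (int j + 1) * int (card (D_set (j + 1) r n)) - int j * int (card (D_set j r n))"
proof -
  have r: "0 < r" using assms by simp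
  note main = length_gf_diff_of_splittings[OF splitting_divisible[OF r] splitting_repeated[OF r]]
  let ?o = "\<lambda>M. card {x \<in> set_mset M. r dvd x}"
  have card_O: "int (card (O_set i r n)) = gf sum_mset Par (\<lambda>M. of_bool (?o M = i)) $ n" for i
    using O_set_sum[of "\<lambda>_. 1" i r n] by simp
  have card_D: "card (D_set i r n) = card (O_set i r n)" for i
    using D_set_sum[of "\<lambda>_. 1" i r n] card_O[of i] main(1)[of "\<lambda>c. of_bool (c = i)"] by simp
  have "b j r n = (gf sum_mset Par (\<lambda>M. of_bool (?o M = j) * int (size M)) -
      gf sum_mset Par (\<lambda>M. of_bool (card {x \<in> set_mset M. r \<le> count M x} = j) * int (size M))) $ n"
    using O_set_sum[of "\<lambda>M. int (size M)" j r n] D_set_sum[of "\<lambda>M. int (size M)" j r n]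
    by (simp add: b_def)
  also have "\<dots> = (fps_const (int r - 1) *
      gf sum_mset Par (\<lambda>M. shift_weight (\<lambda>c. of_bool (c = j)) (?o M))) $ n"
    unfolding main(2)[of "\<lambda>c. of_bool (c = j)"]
    by (simp add: fps_of_nat[symmetric] flip: fps_const_sub)
  also have "\<dots> = (int r - 1) *
      ((int j + 1) * int (card (O_set (j + 1) r n)) - int j * int (card (O_set j r n)))"
    unfolding fps_mult_left_const_nth shift_weight_indicator gf_diff gf_scale card_O fps_sub_nth ..
  finally have "rat_of_int (b j r n) = (rat_of_nat r - 1) *
      rat_of_int ((int j + 1) * int (card (O_set (j + 1) r n)) - int j * int (card (O_set j r n)))"
    by simp
  moreover have "rat_of_nat r - 1 \<noteq> 0"
    using assms by auto
  ultimately show ?thesis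
    by (simp add: card_D)
qed

end
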